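(* For integers $n\ge 1$ and $k\ge 1$ and indeterminates $x_1,\ldots,x_k$, $$\left(\sum_{i=1}^{k}x_i\right)\left(n+\sum_{i=1}^{k}x_i\right)^{n-1}=\sum_{i_1+\cdots+i_k=n}\binom{n}{i_1,\ldots,i_k}\prod_{j=1}^{k}x_j\,(x_j+i_j)^{i_j-1},$$ where the sum is over all $k$-tuples $(i_1,\ldots,i_k)$ of nonnegative integers with sum $n$.
   Context: $\binom{n}{i_1,\ldots,i_k}=\frac{n!}{i_1!\cdots i_k!}$ is the multinomial coefficient. When $i_j=0$ the factor $x_j(x_j+i_j)^{i_j-1}$ is $x_j\cdot x_j^{-1}=1$. *)

theory Defs
  imports
    "HOL-Library.FuncSet"
    "HOL-Library.Poly_Mapping"
    "HOL-Computational_Algebra.Fraction_Field"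
begin

(* (nat =>_0 nat) is the monoid of exponent vectors with finite support, so mpoly_ring is the
   polynomial ring over 'a in the indeterminates x_0, x_1, x_2, ..., and rat_fun its field of
   fractions. *)

type_synonym 'a mpoly_ring = "(nat \<Rightarrow>\<^sub>0 nat) \<Rightarrow>\<^sub>0 'a"
type_synonym 'a rat_fun = "'a mpoly_ring fract"

definition var_poly :: "nat \<Rightarrow> 'a::idom mpoly_ring" where
  "var_poly j = Poly_Mapping.single (Poly_Mapping.single j 1) 1"

definition indet :: "nat \<Rightarrow> 'a::idom rat_fun" where
  "indet j = Fract (var_poly j) 1"

(* k-tuples are functions on {1..k}; being extensional, each tuple is counted exactly once. *)

definition weak_compositions :: "nat \<Rightarrow> nat \<Rightarrow> (nat \<Rightarrow> nat) set" where
  "weak_compositions n k = {i \<in> {1..k} \<rightarrow>\<^sub>E UNIV. (\<Sum>j=1..k. i j) = n}"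

(* The division of natural numbers is exact whenever i 1 + ... + i k = n. *)

definition multinomial :: "nat \<Rightarrow> nat \<Rightarrow> (nat \<Rightarrow> nat) \<Rightarrow> nat" where
  "multinomial n k i = fact n div (\<Prod>j=1..k. fact (i j))"

end

theory Submission
  imports Defs
begin

text \<open>Put a n x = x (x + n) ^ (n - 1) with a 0 x = 1. Once the a-factors are written this way
  the identity says that (a n) is of binomial type: summing (n choose i) * a i x * a (n - i) y over
  i gives a n (x + y). It then holds for k variables by induction on k. The case of two variables
  follows from Abel's identity, where (y + n - i) ^ (n - i) replaces a (n - i) y, because
  a m y = (y + m) ^ m - m (y + m) ^ (m - 1). For Abel's identity, expand (y + n - i) ^ (n - i) in
  powers of x + y + n and x + i: the coefficient of (x + y + n) ^ m is, up to a factor, an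
  (n - m)-th difference of a polynomial of degree n - m - 1, so only m = n survives.\<close>

text \<open>The separate value at 0 replaces x * x^(-1), so all identities up to the last step hold
  in any commutative ring, without division.\<close>

definition abel_poly :: "nat \<Rightarrow> 'a::comm_ring_1 \<Rightarrow> 'a" where
  "abel_poly n x = (if n = 0 then 1 else x * (x + of_nat n) ^ (n - 1))"

text \<open>Absorption, i * (n+1 choose i) = (n+1) * (n choose i-1): a weight i is traded for a
  shift of the summand and a smaller n.\<close>

lemma sum_binomial_split:
  fixes f :: "nat \<Rightarrow> 'a::comm_ring_1"
  shows "(\<Sum>i\<le>Suc n. of_nat (Suc n choose i) * of_nat i * f i) =
    of_nat (Suc n) * (\<Sum>i\<le>n. of_nat (n choose i) * f (Suc i))"
proof -
  have "of_nat (Suc n choose Suc i) * of_nat (Suc i) = (of_nat (Suc n) * of_nat (n choose i) :: 'a)"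
    for i
    by (metis Suc_times_binomial_eq of_nat_mult)
  then show ?thesis
    by (subst sum.atMost_Suc_shift) (simp add: sum_distrib_left mult.assoc[symmetric] del: of_nat_Suc binomial_Suc_Suc)
qed

text \<open>Up to sign, an n-th difference of a polynomial of degree p < n. One factor x + i is
  split off: its x part lowers p alone, and its i part, by absorption, lowers both n and p and moves
  x to x + 1.\<close>

lemma alternating_binomial_sum_power:
  fixes x :: "'a::comm_ring_1"
  assumes "p < n"
  shows "(\<Sum>i\<le>n. of_nat (n choose i) * ((-1) ^ i * (x + of_nat i) ^ p)) = 0"
  using assms
proof (induction p arbitrary: n x)
  case 0
  have "(\<Sum>i\<le>n. of_nat (n choose i) * (-1) ^ i) = (0::'a)"
    using binomial_ring[of "-1::'a" 1 n] 0 by (simp add: zero_power)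
  then show ?case
    by simp
next
  case (Suc p)
  then obtain m where n: "n = Suc m" and p: "p < m"
    by (cases n) auto
  have "(\<Sum>i\<le>n. of_nat (n choose i) * ((-1) ^ i * (x + of_nat i) ^ Suc p)) =
      x * (\<Sum>i\<le>n. of_nat (n choose i) * ((-1) ^ i * (x + of_nat i) ^ p)) +
      (\<Sum>i\<le>n. of_nat (n choose i) * of_nat i * ((-1) ^ i * (x + of_nat i) ^ p))"
    by (simp add: sum_distrib_left sum.distrib[symmetric] algebra_simps)
  also have "(\<Sum>i\<le>n. of_nat (n choose i) * of_nat i * ((-1) ^ i * (x + of_nat i) ^ p)) =
      - (of_nat n * (\<Sum>i\<le>m. of_nat (m choose i) * ((-1) ^ i * ((x + 1) + of_nat i) ^ p)))"
    unfolding n sum_binomial_split by (simp add: sum_negf add.assoc)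
  finally show ?case
    using Suc.IH[of n x] Suc.IH[of m "x + 1"] p Suc.prems by simp
qed

lemma binomial_sum_abel_poly_power:
  fixes x y :: "'a::comm_ring_1"
  shows "(\<Sum>i\<le>n. of_nat (n choose i) * abel_poly i x * (y + of_nat (n - i)) ^ (n - i)) =
    (x + y + of_nat n) ^ n"
proof -
  define s where "s = x + y + of_nat n"
  \<comment> \<open>The coefficient that a power of s will get, with m in the role of n minus the
    exponent of s. For m > 0 the powers of x + i merge into degree m - 1, so the m-th difference
    vanishes.\<close>
  have difference: "(\<Sum>i\<le>m. of_nat (m choose i) * abel_poly i x * (- (x + of_nat i)) ^ (m - i)) =
      (if m = 0 then 1 else 0)" for m
  proof (cases "m = 0")
    case False
    have "abel_poly i x * (- (x + of_nat i)) ^ (m - i) =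
        (-1) ^ m * x * ((-1) ^ i * (x + of_nat i) ^ (m - 1))" if "i \<le> m" for i
    \<comment> \<open>Here \<open>abel_poly\<close> is 1, and the outer factor x has to come from
      (-x)^m instead, which needs m > 0.\<close>
    proof (cases "i = 0")
      case True
      then show ?thesis
        using False by (cases m) (simp_all add: abel_poly_def power_minus[of x])
    next
      case i: False
      have "(x + of_nat i) ^ (m - 1) = (x + of_nat i) ^ (i - 1) * (x + of_nat i) ^ (m - i)"
        unfolding power_add[symmetric] using i that by simp
      then have "abel_poly i x * (- (x + of_nat i)) ^ (m - i) =
          (-1) ^ (m - i) * x * (x + of_nat i) ^ (m - 1)"
        unfolding abel_poly_def power_minus[of "x + of_nat i"] using i by (simp add: mult_ac)
      also have "(-1) ^ (m - i) = ((-1) ^ m * (-1) ^ i :: 'a)"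
        using that by (auto simp: minus_one_power_iff)
      finally show ?thesis
        by (simp add: mult_ac)
    qed
    then have "(\<Sum>i\<le>m. of_nat (m choose i) * abel_poly i x * (- (x + of_nat i)) ^ (m - i)) =
        (-1) ^ m * x * (\<Sum>i\<le>m. of_nat (m choose i) * ((-1) ^ i * (x + of_nat i) ^ (m - 1)))"
      unfolding sum_distrib_left by (intro sum.cong refl) (simp add: mult.assoc)
    then show ?thesis
      using False alternating_binomial_sum_power[of "m - 1" m x] by simp
  qed (simp add: abel_poly_def)
  have "(\<Sum>i\<le>n. of_nat (n choose i) * abel_poly i x * (y + of_nat (n - i)) ^ (n - i)) =
      (\<Sum>i\<le>n. \<Sum>m\<le>n - i. of_nat (n choose i) * of_nat ((n - i) choose m) *
        abel_poly i x * s ^ m * (- (x + of_nat i)) ^ (n - i - m))"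
  proof (intro sum.cong refl)
    fix i assume "i \<in> {..n}"
    then have "y + of_nat (n - i) = s + - (x + of_nat i)"
      by (simp add: s_def of_nat_diff)
    then show "of_nat (n choose i) * abel_poly i x * (y + of_nat (n - i)) ^ (n - i) =
      (\<Sum>m\<le>n - i. of_nat (n choose i) * of_nat ((n - i) choose m) *
        abel_poly i x * s ^ m * (- (x + of_nat i)) ^ (n - i - m))"
      by (simp only: binomial_ring sum_distrib_left mult_ac)
  qed
  \<comment> \<open>Both double sums run over the triangle i + m \<le> n.\<close>
  also have "\<dots> = (\<Sum>m\<le>n. \<Sum>i\<le>n - m. of_nat (n choose i) * of_nat ((n - i) choose m) *
        abel_poly i x * s ^ m * (- (x + of_nat i)) ^ (n - i - m))"
    unfolding sum.Sigma[OF finite_atMost ballI[OF finite_atMost]]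
    by (intro sum.reindex_bij_witness[of _ prod.swap prod.swap]) auto
  also have "\<dots> = (\<Sum>m\<le>n. of_nat (n choose m) * s ^ m *
      (\<Sum>i\<le>n - m. of_nat ((n - m) choose i) * abel_poly i x * (- (x + of_nat i)) ^ (n - m - i)))"
  proof (unfold sum_distrib_left, intro sum.cong refl)
    fix m i assume "m \<in> {..n}" "i \<in> {..n - m}"
    \<comment> \<open>Both sides equal (n choose i+m) * (i+m choose i).\<close>
    then have "(n choose i) * ((n - i) choose m) = (n choose m) * ((n - m) choose i)"
      using choose_mult[of i "i + m" n] choose_mult[of m "i + m" n]
        binomial_symmetric[of m "i + m"] by simp
    from arg_cong[OF this, of "of_nat :: nat \<Rightarrow> 'a"]
    show "of_nat (n choose i) * of_nat ((n - i) choose m) *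
        abel_poly i x * s ^ m * (- (x + of_nat i)) ^ (n - i - m) =
      of_nat (n choose m) * s ^ m *
        (of_nat ((n - m) choose i) * abel_poly i x * (- (x + of_nat i)) ^ (n - m - i))"
      by (simp add: ac_simps)
  qed
  also have "\<dots> = (\<Sum>m\<le>n. if m = n then s ^ n else 0)"
    unfolding difference by (intro sum.cong) auto
  finally show ?thesis
    by (simp add: s_def)
qed

lemma abel_poly_eq_diff:
  "abel_poly n x = (x + of_nat n) ^ n - of_nat n * (x + of_nat n) ^ (n - 1)"
  by (cases n) (simp_all add: abel_poly_def algebra_simps)

lemma binomial_sum_abel_poly:
  fixes x y :: "'a::comm_ring_1"
  shows "(\<Sum>i\<le>n. of_nat (n choose i) * abel_poly (n - i) x * abel_poly i y) = abel_poly n (x + y)"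
proof (cases n)
  case 0
  then show ?thesis
    by (simp add: abel_poly_def)
next
  case (Suc m)
  have reverse: "(\<Sum>i\<le>l. of_nat (l choose i) * abel_poly (l - i) x * (z + of_nat i) ^ i) =
      (x + z + of_nat l) ^ l" for l and z :: 'a
    unfolding binomial_sum_abel_poly_power[symmetric]
    by (rule sum.reindex_bij_witness[of _ "\<lambda>i. l - i" "\<lambda>i. l - i"])
      (auto simp: binomial_symmetric[symmetric])
  have "(\<Sum>i\<le>n. of_nat (n choose i) * abel_poly (n - i) x * abel_poly i y) =
      (\<Sum>i\<le>n. of_nat (n choose i) * abel_poly (n - i) x * (y + of_nat i) ^ i) -
      (\<Sum>i\<le>n. of_nat (n choose i) * of_nat i *
        (abel_poly (n - i) x * (y + of_nat i) ^ (i - 1)))"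
    unfolding abel_poly_eq_diff[of _ y]
    by (simp add: sum_subtractf[symmetric] algebra_simps)
  \<comment> \<open>Both sums are instances of Abel's identity. In the second, absorption turns y +
    i into (y + 1) + i and n into m; as n = m + 1, its base is again x + y + n.\<close>
  also have "\<dots> = (x + y + of_nat n) ^ n - of_nat n * (x + (y + 1) + of_nat m) ^ m"
    unfolding reverse unfolding Suc sum_binomial_split
    using reverse[of m "y + 1"] by (simp add: ac_simps)
  finally show ?thesis
    by (simp add: abel_poly_eq_diff Suc ac_simps)
qed

lemma prod_fact_dvd_fact_sum:
  "finite A \<Longrightarrow> (\<Prod>j\<in>A. fact (i j)) dvd (fact (\<Sum>j\<in>A. i j) :: nat)"
proof (induction A rule: finite_induct)
  case (insert a A)
  then have "fact (i a) * (\<Prod>j\<in>A. fact (i j)) dvd fact (i a) * (fact (\<Sum>j\<in>A. i j) :: nat)"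
    by (intro mult_dvd_mono) auto
  also have "\<dots> dvd fact (i a + (\<Sum>j\<in>A. i j))"
    by (rule fact_fact_dvd_fact)
  finally show ?case
    using insert by simp
qed simp

lemma multinomial_Suc:
  assumes "i \<in> weak_compositions (n - m) k" and "m \<le> n"
  shows "multinomial n (Suc k) (i(Suc k := m)) = (n choose m) * multinomial (n - m) k i"
proof -
  let ?P = "\<Prod>j=1..k. fact (i j) :: nat"
  \<comment> \<open>Exactness of the division allows the factor (n choose m) to be pulled out of
    \<open>div\<close>.\<close>
  have dvd: "?P dvd fact (n - m)"
    using assms prod_fact_dvd_fact_sum[of "{1..k}" i] by (simp add: weak_compositions_def)
  have "fact n = fact m * (fact (n - m) * (n choose m))"
    using binomial_fact_lemma[OF assms(2)] by (simp add: mult_ac)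
  then have "fact n div (?P * fact m) = (n choose m) * (fact (n - m) div ?P)"
    using dvd by (simp add: div_mult_swap mult.commute)
  moreover have "(\<Prod>j=1..k. fact ((i(Suc k := m)) j)) = ?P"
    by (intro prod.cong) auto
  ultimately show ?thesis
    by (simp add: multinomial_def)
qed

lemma sum_weak_compositions_Suc:
  fixes f :: "(nat \<Rightarrow> nat) \<Rightarrow> 'a::comm_monoid_add"
  shows "(\<Sum>i\<in>weak_compositions n (Suc k). f i) =
    (\<Sum>m\<le>n. \<Sum>i\<in>weak_compositions (n - m) k. f (i(Suc k := m)))"
proof -
  have finite: "finite (weak_compositions n k)" for n
  proof (rule finite_subset)
    show "weak_compositions n k \<subseteq> {1..k} \<rightarrow>\<^sub>E {..n}"
      by (auto simp: weak_compositions_def PiE_iff extensional_def intro!: member_le_sum)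
  qed (simp add: finite_PiE)
  have upd: "(\<Sum>j=1..k. (i(Suc k := m)) j) = (\<Sum>j=1..k. i j)" for i :: "nat \<Rightarrow> nat" and m
    by (intro sum.cong) auto
  show ?thesis
    \<comment> \<open>Resetting the entry at \<open>Suc k\<close> to \<open>undefined\<close> makes
      the shortened tuple extensional on {1..k} again.\<close>
    by (subst sum.Sigma[OF finite_atMost], simp add: finite,
        rule sum.reindex_bij_witness[of _ "\<lambda>(m, i). i(Suc k := m)"
          "\<lambda>i. (i (Suc k), i(Suc k := undefined))"])
      (auto simp: weak_compositions_def PiE_iff extensional_def upd fun_eq_iff)
qed

lemma sum_multinomial_abel_poly:
  fixes x :: "nat \<Rightarrow> 'a::comm_ring_1"
  shows "(\<Sum>i\<in>weak_compositions n k. of_nat (multinomial n k i) *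
      (\<Prod>j=1..k. abel_poly (i j) (x j))) = abel_poly n (\<Sum>j=1..k. x j)"
proof (induction k arbitrary: n)
  case 0
  \<comment> \<open>For n > 0 the sum is empty, and \<open>abel_poly n 0\<close> is 0 through its
    factor x.\<close>
  have "weak_compositions n 0 = (if n = 0 then {\<lambda>_. undefined} else {})"
    by (auto simp: weak_compositions_def)
  then show ?case
    by (simp add: multinomial_def abel_poly_def)
next
  case (Suc k)
  have upd: "(\<Prod>j=1..k. abel_poly ((i(Suc k := m)) j) (x j)) =
      (\<Prod>j=1..k. abel_poly (i j) (x j))" for i m
    by (intro prod.cong) auto
  have "(\<Sum>i\<in>weak_compositions n (Suc k). of_nat (multinomial n (Suc k) i) *
        (\<Prod>j=1..Suc k. abel_poly (i j) (x j))) =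
      (\<Sum>m\<le>n. of_nat (n choose m) * (\<Sum>i\<in>weak_compositions (n - m) k.
        of_nat (multinomial (n - m) k i) * (\<Prod>j=1..k. abel_poly (i j) (x j))) *
        abel_poly m (x (Suc k)))"
    unfolding sum_weak_compositions_Suc sum_distrib_left sum_distrib_right
    by (intro sum.cong refl) (simp add: multinomial_Suc upd mult_ac del: fun_upd_apply, simp)
  also have "\<dots> = abel_poly n (\<Sum>j=1..Suc k. x j)"
    unfolding Suc.IH binomial_sum_abel_poly by simp
  finally show ?case .
qed

lemma indet_nonzero: "(indet j :: 'a::idom rat_fun) \<noteq> 0"
proof -
  have "(var_poly j :: 'a mpoly_ring) \<noteq> 0"
    by (metis lookup_single_eq lookup_zero var_poly_def zero_neq_one)
  then show ?thesis
    by (simp add: indet_def Zero_fract_def eq_fract)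
qed

text \<open>Only n = 0 uses that x is nonzero: the exponent is then -1 and x cancels.\<close>

lemma abel_poly_eq_powi:
  fixes x :: "'a::field"
  assumes "x \<noteq> 0"
  shows "x * (x + of_nat n) powi (int n - 1) = abel_poly n x"
  using assms by (cases n) (simp_all add: abel_poly_def power_int_minus)

theorem theorem2p2:
  fixes n k :: nat
  assumes "n \<ge> 1" and "k \<ge> 1"
  shows "(\<Sum>j=1..k. indet j :: 'a::idom rat_fun) * (of_nat n + (\<Sum>j=1..k. indet j)) ^ (n - 1) =
    (\<Sum>i\<in>weak_compositions n k. of_nat (multinomial n k i) *
      (\<Prod>j=1..k. indet j * (indet j + of_nat (i j)) powi (int (i j) - 1)))"
  using assms
  by (simp only: abel_poly_eq_powi[OF indet_nonzero] sum_multinomial_abel_poly)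
    (simp add: abel_poly_def add.commute)

end
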